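(* Let $\mathcal{F}_2$ be the class of functions $f\in\mathcal{A}$ such that $\operatorname{Re}\left(f(z)/g(z)\right)>0$ for all $z\in\mathbb{D}$, for some $g\in\mathcal{A}$ with $\operatorname{Re}\left(g(z)/z\right)>\tfrac12$ for all $z\in\mathbb{D}$. Then the following radius results hold: (a) the $\mathcal{S}_{\mathcal{L}}$-radius of $\mathcal{F}_2$ is $R_{\mathcal{S}_{\mathcal{L}}}(\mathcal{F}_2)=\dfrac{4-2\sqrt2}{\sqrt2\left(\sqrt{17-4\sqrt2}+3\right)}$; (b) for every $\beta>1$, the $\mathcal{M}(\beta)$-radius of $\mathcal{F}_2$ is $R_{\mathcal{M}(\beta)}(\mathcal{F}_2)=\dfrac{2(\beta-1)}{3+\sqrt{9+4\beta(\beta-1)}}$; (c) for every $0\le\alpha<1$, the $\mathcal{S}^*(\alpha)$-radius of $\mathcal{F}_2$ is $R_{\mathcal{S}^*(\alpha)}(\mathcal{F}_2)=\dfrac{2(1-\alpha)}{3+\sqrt{9-4\alpha+4\alpha^2}}$; (d) the $\mathcal{S}_{\mathcal{P}}$-radius of $\mathcal{F}_2$ satisfies $R_{\mathcal{S}_{\mathcal{P}}}(\mathcal{F}_2)\ge -3+\sqrt{10}$. The radii in (a), (b) and (c) are sharp (exact values).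
   Context: $\mathbb{D}=\{z\in\mathbb{C}:|z|<1\}$. $\mathcal{A}$ is the class of analytic functions $f$ on $\mathbb{D}$ with $f(0)=0$ and $f'(0)=1$; $\mathcal{S}\subset\mathcal{A}$ is the subclass of univalent (injective) functions. Quotients such as $f(z)/g(z)$, $g(z)/z$, $zf'(z)/f(z)$ with $f,g\in\mathcal{A}$ are understood at $z=0$ by their limit value $1$. For $0\le\alpha<1$, $\mathcal{S}^*(\alpha)$ is the class of $f\in\mathcal{S}$ with $\operatorname{Re}(zf'(z)/f(z))>\alpha$ on $\mathbb{D}$ (starlike of order $\alpha$). $\mathcal{S}_{\mathcal{L}}$ is the class of $f\in\mathcal{A}$ with $\left|\left(zf'(z)/f(z)\right)^2-1\right|<1$ and with $zf'(z)/f(z)$ lying in the right half of the lemniscate region, for $z\in\mathbb{D}$. For $\beta>1$, $\mathcal{M}(\beta)$ is the class of $f\in\mathcal{A}$ with $\operatorname{Re}(zf'(z)/f(z))<\beta$ on $\mathbb{D}$. $\mathcal{S}_{\mathcal{P}}$ (parabolic starlike functions) is the class of $f\in\mathcal{A}$ with $\operatorname{Re}(zf'(z)/f(z))>\left|zf'(z)/f(z)-1\right|$ on $\mathbb{D}$. For families $\mathcal{G},\mathcal{F}\subset\mathcal{A}$, the $\mathcal{G}$-radius of $\mathcal{F}$, denoted $R_{\mathcal{G}}(\mathcal{F})$, is the largest number $R$ such that the function $z\mapsto r^{-1}f(rz)$ belongs to $\mathcal{G}$ for all $0<r\le R$ and all $f\in\mathcal{F}$. *)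

theory Defs
  imports "HOL-Complex_Analysis.Complex_Analysis"
begin

abbreviation unit_disk :: "complex set" where
  "unit_disk \<equiv> ball 0 1"

text \<open>
  Functions on the disk are total functions on the complex plane; every class below depends only
  on the values inside the disk.
\<close>

definition class_A :: "(complex \<Rightarrow> complex) set" where
  "class_A = {f. f holomorphic_on unit_disk \<and> f 0 = 0 \<and> deriv f 0 = 1}"

definition class_S :: "(complex \<Rightarrow> complex) set" where
  "class_S = {f \<in> class_A. inj_on f unit_disk}"

text \<open>
  The quotients formed below are all of the shape \<open>f / g\<close> with \<open>f\<close> and \<open>g\<close> vanishing at \<open>0\<close> and
  having derivative \<open>1\<close> there, so that their limit value at \<open>0\<close> is \<open>1\<close>.
\<close>

definition nquot :: "(complex \<Rightarrow> complex) \<Rightarrow> (complex \<Rightarrow> complex) \<Rightarrow> complex \<Rightarrow> complex" where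
  "nquot f g z = (if z = 0 then 1 else f z / g z)"

definition log_quot :: "(complex \<Rightarrow> complex) \<Rightarrow> complex \<Rightarrow> complex" where
  "log_quot f = nquot (\<lambda>z. z * deriv f z) f"

definition starlike_class :: "real \<Rightarrow> (complex \<Rightarrow> complex) set" where
  "starlike_class \<alpha> = {f \<in> class_S. \<forall>z\<in>unit_disk. Re (log_quot f z) > \<alpha>}"

text \<open>The right half of the lemniscate region is its part in the open right half-plane.\<close>

definition lemniscate_class :: "(complex \<Rightarrow> complex) set" where
  "lemniscate_class =
     {f \<in> class_A. \<forall>z\<in>unit_disk. norm ((log_quot f z)\<^sup>2 - 1) < 1 \<and> Re (log_quot f z) > 0}"

text \<open>
  The condition \<open>f z \<noteq> 0\<close> says that \<open>z f'(z) / f(z)\<close> is defined; without it, the convention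
  \<open>x / 0 = 0\<close> would make the bound hold at zeros of \<open>f\<close>. In the other classes a zero of \<open>f\<close>
  away from the origin already violates the defining inequality, which fails for the value \<open>0\<close>.
\<close>

definition M_class :: "real \<Rightarrow> (complex \<Rightarrow> complex) set" where
  "M_class \<beta> =
     {f \<in> class_A. (\<forall>z\<in>unit_disk - {0}. f z \<noteq> 0) \<and> (\<forall>z\<in>unit_disk. Re (log_quot f z) < \<beta>)}"

definition parabolic_class :: "(complex \<Rightarrow> complex) set" where
  "parabolic_class =
     {f \<in> class_A. \<forall>z\<in>unit_disk. Re (log_quot f z) > norm (log_quot f z - 1)}"

definition F2_class :: "(complex \<Rightarrow> complex) set" where
  "F2_class =
     {f \<in> class_A. \<exists>g\<in>class_A. (\<forall>z\<in>unit_disk. Re (nquot g (\<lambda>w. w) z) > 1 / 2)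
                              \<and> (\<forall>z\<in>unit_disk. Re (nquot f g z) > 0)}"

text \<open>
  The bound \<open>R \<le> 1\<close> reflects that \<open>f (r z)\<close> is meaningful for all \<open>z\<close> in the disk only if
  \<open>r \<le> 1\<close>.
\<close>

definition admissible_radii ::
    "(complex \<Rightarrow> complex) set \<Rightarrow> (complex \<Rightarrow> complex) set \<Rightarrow> real set" where
  "admissible_radii G F =
     {R. 0 \<le> R \<and> R \<le> 1 \<and>
         (\<forall>r. 0 < r \<and> r \<le> R \<longrightarrow>
            (\<forall>f\<in>F. (\<lambda>z. f (complex_of_real r * z) / complex_of_real r) \<in> G))}"

text \<open>\<open>R\<close> is the \<open>G\<close>-radius of \<open>F\<close>.\<close>

definition is_radius ::
    "(complex \<Rightarrow> complex) set \<Rightarrow> (complex \<Rightarrow> complex) set \<Rightarrow> real \<Rightarrow> bool" where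
  "is_radius G F R \<longleftrightarrow>
     R \<in> admissible_radii G F \<and> (\<forall>R'\<in>admissible_radii G F. R' \<le> R)"

end

theory Submission
  imports Defs
begin

text \<open>
  Write \<open>f \<in> F2_class\<close> as \<open>f z = z * p z * h z\<close>, where \<open>p = f / g\<close> has positive real part and
  \<open>h z = g z / z\<close> has real part above \<open>1 / 2\<close> with \<open>h 0 = 1\<close>. Logarithmic differentiation gives
  \<open>z f'(z) / f(z) = 1 + z p'(z) / p(z) + z h'(z) / h(z)\<close>, and with \<open>r = |z|\<close> the two summands are
  controlled by three estimates:
  \<^item> \<open>|z p' / p| \<le> 2 r / (1 - r\<^sup>2)\<close>, which is the Schwarz--Pick inequality for the Cayley transform
    of \<open>p\<close>;
  \<^item> \<open>|z h' / h| \<le> r / (1 - r)\<close>, which is the Schwarz--Pick inequality for the Schwarz function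
    \<open>\<phi> = 1 / h - 1\<close>;
  \<^item> \<open>Re (z h' / h) \<ge> - r / (1 + r)\<close> for \<open>r \<le> 1 / 3\<close>, a sharper one-sided bound, which needs
    Schwarz--Pick for \<open>\<phi> z / z\<close> instead.

  Hence \<open>|z f' / f - 1| \<le> (3 r + r\<^sup>2) / (1 - r\<^sup>2)\<close>, and \<open>Re (z f' / f) \<ge> (1 - 3 r) / (1 - r\<^sup>2)\<close> for
  \<open>r \<le> 1 / 3\<close>. The function \<open>z (1 + z) / (1 - z)\<^sup>2\<close> belongs to the family and has
  \<open>z f' / f = (1 + 3 z) / (1 - z\<^sup>2)\<close>. Compared with \<open>\<beta>\<close>, resp. \<open>\<alpha>\<close>, its values at \<open>z = r\<close> and
  \<open>z = - r\<close> lead to the same equations \<open>\<beta> r\<^sup>2 + 3 r = \<beta> - 1\<close> and \<open>- \<alpha> r\<^sup>2 + 3 r = 1 - \<alpha>\<close> as the two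
  estimates. Thus the radii in (b) and (c) are the smallest positive roots of these, and are sharp. Part (a) is part (b) with
  \<open>\<beta> = sqrt 2\<close>, because the disk of radius \<open>sqrt 2 - 1\<close> about \<open>1\<close> lies in the right half of the
  lemniscate region and touches its boundary at \<open>sqrt 2\<close>. For (d) the two estimates together give
  \<open>Re (z f' / f) - |z f' / f - 1| \<ge> 1 - 6 r / (1 - r\<^sup>2)\<close>, which is positive for
  \<open>r < sqrt 10 - 3\<close>; the radius itself exists because the set of admissible radii contains its
  supremum.

  Each of the four classes is determined, among the functions in question, by the region that
  \<open>z f' / f\<close> must stay in. For the starlike classes this includes the classical fact that a starlike
  function is univalent: in the coordinate \<open>\<zeta> = Ln z\<close> the logarithm of \<open>f\<close> has derivative
  \<open>z f' / f\<close>, of positive real part on a half-plane, so it is injective there.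
\<close>

section \<open>Schwarz--Pick inequalities\<close>

text \<open>
  Moebius transformations that move \<open>z\<close> and \<open>f z\<close> to the origin reduce the claim to the bound
  \<open>|k'(0)| \<le> 1\<close> of the Schwarz lemma; the two factors are their derivatives at the base points.
\<close>

lemma Schwarz_Pick_deriv:
  assumes hol: "f holomorphic_on ball 0 1" and bd: "\<And>z. norm z < 1 \<Longrightarrow> norm (f z) < 1"
    and z: "norm z < 1"
  shows "norm (deriv f z) * (1 - (norm z)\<^sup>2) \<le> 1 - (norm (f z))\<^sup>2"
proof -
  define w where "w = f z"
  have w: "norm w < 1" using bd z by (simp add: w_def)
  define \<phi> where "\<phi> = Moebius_function 0 (- z)"
  define \<psi> where "\<psi> = Moebius_function 0 w"
  define k where "k = \<psi> \<circ> f \<circ> \<phi>"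
  have \<phi>0: "\<phi> 0 = z" by (simp add: \<phi>_def Moebius_function_of_zero)
  have \<psi>w: "\<psi> w = 0" by (simp add: \<psi>_def Moebius_function_eq_zero)
  have \<phi>b: "norm (\<phi> v) < 1" if "norm v < 1" for v
    using Moebius_function_norm_lt_1[of "-z" v 0] z that by (simp add: \<phi>_def)
  have \<psi>b: "norm (\<psi> v) < 1" if "norm v < 1" for v
    using Moebius_function_norm_lt_1[of w v 0] w that by (simp add: \<psi>_def)
  have \<phi>h: "\<phi> holomorphic_on ball 0 1" and \<psi>h: "\<psi> holomorphic_on ball 0 1"
    using z w by (auto simp: \<phi>_def \<psi>_def intro!: Moebius_function_holomorphic)
  have "f \<circ> \<phi> holomorphic_on ball 0 1"
    using \<phi>b by (intro holomorphic_on_compose_gen[OF \<phi>h hol]) auto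
  then have kh: "k holomorphic_on ball 0 1"
    unfolding k_def comp_assoc using \<phi>b bd
    by (intro holomorphic_on_compose_gen[OF _ \<psi>h]) auto
  have kb: "norm (k v) < 1" if "norm v < 1" for v
    using \<phi>b bd \<psi>b that by (simp add: k_def)
  have k0: "k 0 = 0" using \<psi>w by (simp add: k_def \<phi>0 w_def)
  have 1: "norm (deriv k 0) \<le> 1"
    using Schwarz_Lemma(2)[OF kh k0 kb, of 0] by simp
  have sq: "1 - cnj v * v = of_real (1 - (norm v)\<^sup>2)" for v
    by (metis complex_norm_square mult.commute of_real_1 of_real_diff of_real_power)
  have pos: "(norm v)\<^sup>2 < 1" if "norm v < 1" for v :: complex
    using that by (simp add: abs_square_less_1)
  have d\<phi>: "(\<phi> has_field_derivative of_real (1 - (norm z)\<^sup>2)) (at 0)"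
    unfolding \<phi>_def Moebius_function_simple sq[symmetric]
    by (auto intro!: derivative_eq_intros)
  have wn: "1 - cnj w * w \<noteq> 0" using pos[OF w] unfolding sq by (metis diff_gt_0_iff_gt of_real_eq_0_iff less_irrefl)
  have d\<psi>: "(\<psi> has_field_derivative 1 / of_real (1 - (norm w)\<^sup>2)) (at w)"
    unfolding \<psi>_def Moebius_function_simple sq[symmetric]
    using wn by (auto intro!: derivative_eq_intros)
  have df: "(f has_field_derivative deriv f z) (at z)"
    using hol z by (intro holomorphic_derivI[of _ "ball 0 1"]) auto
  have "(k has_field_derivative (1 / of_real (1 - (norm w)\<^sup>2)) * (deriv f z * of_real (1 - (norm z)\<^sup>2))) (at 0)"
    unfolding k_def comp_assoc
    using d\<phi> d\<psi> df by (intro DERIV_chain) (auto simp: \<phi>0 w_def)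
  then have "deriv k 0 = (1 / of_real (1 - (norm w)\<^sup>2)) * (deriv f z * of_real (1 - (norm z)\<^sup>2))"
    by (rule DERIV_imp_deriv)
  with 1 have "norm (deriv f z) * (1 - (norm z)\<^sup>2) / (1 - (norm w)\<^sup>2) \<le> 1"
    using pos[OF w] pos[OF z] by (simp add: norm_mult norm_divide del: of_real_diff of_real_power)
  then show ?thesis using pos[OF w] by (simp add: w_def)
qed

text \<open>
  The weak bound \<open>|f| \<le> 1\<close> lets in the unimodular constants, which arise below as \<open>\<phi> z / z\<close> for a
  rotation \<open>\<phi>\<close>. Apply the strict version to \<open>s f\<close> and let \<open>s\<close> tend to \<open>1\<close>.
\<close>

lemma Schwarz_Pick_deriv_closed:
  assumes hol: "f holomorphic_on ball 0 1" and bd: "\<And>z. norm z < 1 \<Longrightarrow> norm (f z) \<le> 1"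
    and z: "norm z < 1"
  shows "norm (deriv f z) * (1 - (norm z)\<^sup>2) \<le> 1 - (norm (f z))\<^sup>2"
proof -
  have *: "s * norm (deriv f z) * (1 - (norm z)\<^sup>2) \<le> 1 - s\<^sup>2 * (norm (f z))\<^sup>2"
    if s: "0 < s" "s < 1" for s :: real
  proof -
    have "norm (of_real s * f v) < 1" if "norm v < 1" for v
    proof -
      have "s * norm (f v) \<le> s * 1" using bd[OF that] s by (intro mult_left_mono) auto
      then have "s * norm (f v) < 1" using s by linarith
      then show ?thesis using s by (simp add: norm_mult)
    qed
    moreover have "(\<lambda>v. of_real s * f v) holomorphic_on ball 0 1"
      by (intro holomorphic_intros hol)
    ultimately have "norm (deriv (\<lambda>v. of_real s * f v) z) * (1 - (norm z)\<^sup>2)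
        \<le> 1 - (norm (of_real s * f z))\<^sup>2"
      using Schwarz_Pick_deriv z by blast
    moreover have "deriv (\<lambda>v. of_real s * f v) z = of_real s * deriv f z"
      using hol z by (intro deriv_cmult holomorphic_on_imp_differentiable_at[of _ "ball 0 1"]) auto
    ultimately show ?thesis using s by (simp add: norm_mult power_mult_distrib)
  qed
  have "((\<lambda>s. s * norm (deriv f z) * (1 - (norm z)\<^sup>2)) \<longlongrightarrow> 1 * norm (deriv f z) * (1 - (norm z)\<^sup>2)) (at_left (1::real))"
    and "((\<lambda>s. 1 - s\<^sup>2 * (norm (f z))\<^sup>2) \<longlongrightarrow> 1 - 1\<^sup>2 * (norm (f z))\<^sup>2) (at_left (1::real))"
    by (intro tendsto_intros)+
  moreover have "\<forall>\<^sub>F s in at_left (1::real). s * norm (deriv f z) * (1 - (norm z)\<^sup>2) \<le> 1 - s\<^sup>2 * (norm (f z))\<^sup>2"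
    using * by (auto simp: eventually_at_left_field intro!: exI[of _ 0])
  ultimately show ?thesis
    using tendsto_le[OF trivial_limit_at_left_real] by fastforce
qed

text \<open>
  Writing \<open>\<phi> z = z \<psi> z\<close> one has \<open>z \<phi>' - \<phi> = z\<^sup>2 \<psi>'\<close>, and the Schwarz lemma makes \<open>|\<psi>| \<le> 1\<close>. In
  contrast to the Schwarz--Pick bound on \<open>\<phi>'\<close>, this locates \<open>z \<phi>'\<close> in a disk about \<open>\<phi>\<close> that shrinks
  to a point as \<open>|\<phi> z|\<close> approaches \<open>|z|\<close>, so it carries information on the argument of \<open>z \<phi>'\<close>.
\<close>

lemma Schwarz_function_deriv_defect:
  assumes hol: "\<phi> holomorphic_on ball 0 1" and \<phi>0: "\<phi> 0 = 0"
    and bd: "\<And>z. norm z < 1 \<Longrightarrow> norm (\<phi> z) < 1" and z: "norm z < 1"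
  shows "norm (z * deriv \<phi> z - \<phi> z) * (1 - (norm z)\<^sup>2) \<le> (norm z)\<^sup>2 - (norm (\<phi> z))\<^sup>2"
proof -
  define \<psi> where "\<psi> = (\<lambda>z. if z = 0 then deriv \<phi> 0 else \<phi> z / z)"
  have \<psi>h: "\<psi> holomorphic_on ball 0 1"
    by (rule pole_theorem_open_0[OF hol, of 0]) (auto simp: \<psi>_def \<phi>0)
  have eq: "\<phi> v = v * \<psi> v" for v by (simp add: \<psi>_def \<phi>0)
  have \<psi>b: "norm (\<psi> v) \<le> 1" if "norm v < 1" for v
    using Schwarz_Lemma(1,2)[OF hol \<phi>0 bd that]
    by (auto simp: \<psi>_def norm_divide divide_le_eq_1)
  have d: "(\<psi> has_field_derivative deriv \<psi> z) (at z)"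
    using \<psi>h z by (intro holomorphic_derivI[of _ "ball 0 1"]) auto
  have "((\<lambda>v. v * \<psi> v) has_field_derivative \<psi> z + z * deriv \<psi> z) (at z)"
    by (rule derivative_eq_intros d refl | simp)+
  then have "deriv \<phi> z = \<psi> z + z * deriv \<psi> z"
    unfolding eq[symmetric] by (rule DERIV_imp_deriv)
  then have "z * deriv \<phi> z - \<phi> z = z\<^sup>2 * deriv \<psi> z"
    by (simp add: eq[of z] algebra_simps power2_eq_square)
  then have "norm (z * deriv \<phi> z - \<phi> z) * (1 - (norm z)\<^sup>2)
      = (norm z)\<^sup>2 * (norm (deriv \<psi> z) * (1 - (norm z)\<^sup>2))"
    by (simp add: norm_mult norm_power)
  also have "\<dots> \<le> (norm z)\<^sup>2 * (1 - (norm (\<psi> z))\<^sup>2)"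
    using Schwarz_Pick_deriv_closed[OF \<psi>h \<psi>b z] by (intro mult_left_mono) auto
  also have "\<dots> = (norm z)\<^sup>2 - (norm (\<phi> z))\<^sup>2"
    by (simp add: eq[of z] norm_mult power_mult_distrib algebra_simps)
  finally show ?thesis .
qed

section \<open>Logarithmic derivatives of functions into a half-plane\<close>

lemma norm_Cayley_less_1:
  assumes "Re p > 0" shows "norm ((p - 1) / (p + 1)) < 1"
proof -
  have "(norm (p - 1))\<^sup>2 < (norm (p + 1))\<^sup>2"
    unfolding cmod_power2 using assms by (simp add: power2_eq_square algebra_simps)
  then have "norm (p - 1) < norm (p + 1)" by (rule power2_less_imp_less) simp
  then show ?thesis by (simp add: norm_divide divide_less_eq_1)
qed

text \<open>
  Schwarz--Pick for the Cayley transform \<open>\<omega> = (p - 1) / (p + 1)\<close> reads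
  \<open>|p'| (1 - |z|\<^sup>2) \<le> 2 Re p\<close>, since \<open>1 - |\<omega>|\<^sup>2 = 4 Re p / |p + 1|\<^sup>2\<close>.
\<close>

lemma log_deriv_bound_pos_Re:
  assumes hol: "p holomorphic_on ball 0 1" and pos: "\<And>z. norm z < 1 \<Longrightarrow> Re (p z) > 0"
    and z: "norm z < 1"
  shows "norm (z * deriv p z / p z) \<le> 2 * norm z / (1 - (norm z)\<^sup>2)"
proof -
  have nz: "p v \<noteq> 0" "p v + 1 \<noteq> 0" if "norm v < 1" for v
  proof -
    show "p v \<noteq> 0" using pos[OF that] by auto
    have "Re (p v + 1) > 0" using pos[OF that] by simp
    then show "p v + 1 \<noteq> 0" by force
  qed
  define \<omega> where "\<omega> = (\<lambda>v. (p v - 1) / (p v + 1))"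
  have \<omega>h: "\<omega> holomorphic_on ball 0 1"
    unfolding \<omega>_def using nz by (intro holomorphic_intros hol) auto
  have \<omega>b: "norm (\<omega> v) < 1" if "norm v < 1" for v
    using pos[OF that] by (auto simp: \<omega>_def intro!: norm_Cayley_less_1)
  have d: "(p has_field_derivative deriv p z) (at z)"
    using hol z by (intro holomorphic_derivI[of _ "ball 0 1"]) auto
  have "(\<omega> has_field_derivative 2 * deriv p z / (p z + 1)\<^sup>2) (at z)"
    unfolding \<omega>_def using nz[OF z]
    by (auto intro!: derivative_eq_intros d simp: power2_eq_square field_simps)
  then have d\<omega>: "deriv \<omega> z = 2 * deriv p z / (p z + 1)\<^sup>2" by (rule DERIV_imp_deriv)
  have r: "1 - (norm z)\<^sup>2 > 0" using z by (simp add: abs_square_less_1)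
  have a: "(norm (p z + 1))\<^sup>2 > 0" using nz[OF z] by simp
  have "norm (deriv \<omega> z) * (1 - (norm z)\<^sup>2) \<le> 1 - (norm (\<omega> z))\<^sup>2"
    by (rule Schwarz_Pick_deriv[OF \<omega>h \<omega>b z])
  also have "1 - (norm (\<omega> z))\<^sup>2 = 4 * Re (p z) / (norm (p z + 1))\<^sup>2"
  proof -
    have "(norm (p z + 1))\<^sup>2 - (norm (p z - 1))\<^sup>2 = 4 * Re (p z)"
      unfolding cmod_power2 by (simp add: power2_eq_square algebra_simps)
    then have "4 * Re (p z) / (norm (p z + 1))\<^sup>2
        = ((norm (p z + 1))\<^sup>2 - (norm (p z - 1))\<^sup>2) / (norm (p z + 1))\<^sup>2" by simp
    also have "\<dots> = 1 - (norm (\<omega> z))\<^sup>2"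
    proof -
      have "(norm (\<omega> z))\<^sup>2 = (norm (p z - 1))\<^sup>2 / (norm (p z + 1))\<^sup>2"
        by (simp add: \<omega>_def norm_divide power_divide)
      then show ?thesis using nz[OF z] by (simp add: diff_divide_distrib)
    qed
    finally show ?thesis by simp
  qed
  finally have "2 * norm (deriv p z) * (1 - (norm z)\<^sup>2) / (norm (p z + 1))\<^sup>2 \<le> 4 * Re (p z) / (norm (p z + 1))\<^sup>2"
    by (simp add: d\<omega> norm_divide norm_mult norm_power)
  then have "norm (deriv p z) * (1 - (norm z)\<^sup>2) \<le> 2 * Re (p z)"
    using a by (simp add: divide_le_cancel)
  also have "\<dots> \<le> 2 * norm (p z)" by (simp add: complex_Re_le_cmod)
  finally have "norm (deriv p z) / norm (p z) \<le> 2 / (1 - (norm z)\<^sup>2)"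
    using r nz[OF z] by (simp add: field_simps)
  from mult_left_mono[OF this norm_ge_zero[of z]] show ?thesis
    by (simp add: norm_divide norm_mult mult.commute)
qed

lemma norm_inverse_minus_1_less_1_iff:
  assumes "h \<noteq> 0" shows "norm (1 / h - 1) < 1 \<longleftrightarrow> Re h > 1 / 2"
proof -
  have "norm (1 / h - 1) < 1 \<longleftrightarrow> norm (1 - h) < norm h"
    using assms by (simp add: divide_simps flip: norm_divide) (simp add: norm_divide divide_less_eq_1)
  also have "\<dots> \<longleftrightarrow> (norm (1 - h))\<^sup>2 < (norm h)\<^sup>2"
    by (auto intro: power_strict_mono power2_less_imp_less)
  also have "\<dots> \<longleftrightarrow> Re h > 1 / 2"
    unfolding cmod_power2 by (auto simp: power2_eq_square algebra_simps)
  finally show ?thesis .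
qed

text \<open>
  The map \<open>w \<mapsto> 1 / w - 1\<close> takes the half-plane \<open>Re w > 1 / 2\<close> onto the unit disk and \<open>1\<close> to \<open>0\<close>.
\<close>

lemma half_plane_reciprocal_Schwarz:
  assumes hol: "h holomorphic_on ball 0 1" and h0: "h 0 = 1"
    and half: "\<And>z. norm z < 1 \<Longrightarrow> Re (h z) > 1 / 2"
  obtains \<phi> where "\<phi> holomorphic_on ball 0 1" "\<phi> 0 = 0"
    "\<And>z. norm z < 1 \<Longrightarrow> norm (\<phi> z) < 1"
    "\<And>z. norm z < 1 \<Longrightarrow> deriv h z / h z = - (deriv \<phi> z / (1 + \<phi> z))"
proof
  define \<phi> where "\<phi> = (\<lambda>z. 1 / h z - 1)"
  have nz: "h z \<noteq> 0" if "norm z < 1" for z using half[OF that] by auto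
  show "\<phi> holomorphic_on ball 0 1"
    unfolding \<phi>_def using nz by (intro holomorphic_intros hol) auto
  show "\<phi> 0 = 0" by (simp add: \<phi>_def h0)
  show "norm (\<phi> z) < 1" if "norm z < 1" for z
    unfolding \<phi>_def using half[OF that] nz[OF that] by (simp add: norm_inverse_minus_1_less_1_iff)
  show "deriv h z / h z = - (deriv \<phi> z / (1 + \<phi> z))" if z: "norm z < 1" for z
  proof -
    have d: "(h has_field_derivative deriv h z) (at z)"
      using hol z by (intro holomorphic_derivI[of _ "ball 0 1"]) auto
    have "(\<phi> has_field_derivative - deriv h z / (h z)\<^sup>2) (at z)"
      unfolding \<phi>_def using nz[OF z]
      by (auto intro!: derivative_eq_intros d simp: power2_eq_square)
    then have "deriv \<phi> z = - deriv h z / (h z)\<^sup>2" by (rule DERIV_imp_deriv)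
    then show ?thesis using nz[OF z] by (simp add: \<phi>_def power2_eq_square)
  qed
qed

text \<open>
  In \<open>z \<phi>' / (1 + \<phi>)\<close> bound \<open>|1 + \<phi>|\<close> below by \<open>1 - |\<phi>|\<close>, which cancels one factor of
  \<open>1 - |\<phi>|\<^sup>2\<close> from Schwarz--Pick; the other factor satisfies \<open>1 + |\<phi>| \<le> 1 + |z|\<close>.
\<close>

lemma log_deriv_bound_half_plane:
  assumes hol: "h holomorphic_on ball 0 1" and h0: "h 0 = 1"
    and half: "\<And>z. norm z < 1 \<Longrightarrow> Re (h z) > 1 / 2"
    and z: "norm z < 1"
  shows "norm (z * deriv h z / h z) \<le> norm z / (1 - norm z)"
proof -
  from half_plane_reciprocal_Schwarz[OF hol h0 half] obtain \<phi>
    where \<phi>h: "\<phi> holomorphic_on ball 0 1" and \<phi>0: "\<phi> 0 = 0"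
      and \<phi>b: "\<And>z. norm z < 1 \<Longrightarrow> norm (\<phi> z) < 1"
      and eq: "\<And>z. norm z < 1 \<Longrightarrow> deriv h z / h z = - (deriv \<phi> z / (1 + \<phi> z))" by blast
  define r m where "r = norm z" and "m = norm (\<phi> z)"
  have r: "0 \<le> r" "r < 1" and m: "0 \<le> m" "m < 1" "m \<le> r"
    using z \<phi>b Schwarz_Lemma(1)[OF \<phi>h \<phi>0 \<phi>b z] by (auto simp: r_def m_def)
  have r2: "1 - r\<^sup>2 = (1 - r) * (1 + r)" by (simp add: power2_eq_square algebra_simps)
  have "norm (deriv \<phi> z) * (1 - r\<^sup>2) \<le> 1 - m\<^sup>2"
    unfolding r_def m_def by (rule Schwarz_Pick_deriv[OF \<phi>h \<phi>b z])
  also have "\<dots> = (1 - m) * (1 + m)" by (simp add: power2_eq_square algebra_simps)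
  also have "\<dots> \<le> norm (1 + \<phi> z) * (1 + r)"
  proof (intro mult_mono)
    show "1 - m \<le> norm (1 + \<phi> z)" using norm_diff_ineq[of 1 "\<phi> z"] by (simp add: m_def)
  qed (use m in auto)
  finally have "norm (deriv \<phi> z) * (1 - r) * (1 + r) \<le> norm (1 + \<phi> z) * (1 + r)"
    by (simp add: r2 mult.assoc)
  then have a: "norm (deriv \<phi> z) * (1 - r) \<le> norm (1 + \<phi> z)"
    using r by (simp add: mult_le_cancel_right)
  have "1 + \<phi> z \<noteq> 0" using \<phi>b[OF z] by (metis add_eq_0_iff2 less_irrefl norm_minus_cancel norm_one)
  then have b: "norm (deriv \<phi> z) / norm (1 + \<phi> z) \<le> 1 / (1 - r)"
    using a r by (simp add: field_simps)
  have "norm (z * deriv h z / h z) = r * norm (deriv h z / h z)"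
    by (simp add: r_def norm_mult norm_divide)
  also have "\<dots> = r * (norm (deriv \<phi> z) / norm (1 + \<phi> z))"
    unfolding eq[OF z] by (simp add: norm_divide)
  also have "\<dots> \<le> r * (1 / (1 - r))" using b r by (intro mult_left_mono) auto
  finally show ?thesis by (simp add: r_def)
qed

text \<open>
  With \<open>u = 1 + \<phi> z\<close>, the disk for \<open>z \<phi>'\<close> bounds \<open>Re (z \<phi>' / u)\<close> by an expression in \<open>x = Re u\<close>
  and \<open>t = |u|\<close>. It increases in \<open>x\<close>, so the worst case is \<open>x = t\<close>, and then for \<open>r \<le> 1 / 3\<close> it is
  largest at the endpoint \<open>t = 1 + r\<close>, attained for \<open>\<phi> z = z\<close>. The bound is false for \<open>r\<close> close to
  \<open>1\<close>: if \<open>\<phi> z = z\<^sup>2\<close>, the left side is \<open>- 2 r\<^sup>2 / (1 + r\<^sup>2)\<close> at \<open>z = r\<close>.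
\<close>

lemma Re_log_deriv_bound_half_plane:
  assumes hol: "h holomorphic_on ball 0 1" and h0: "h 0 = 1"
    and half: "\<And>z. norm z < 1 \<Longrightarrow> Re (h z) > 1 / 2"
    and z: "norm z \<le> 1 / 3"
  shows "Re (z * deriv h z / h z) \<ge> - (norm z / (1 + norm z))"
proof -
  from half_plane_reciprocal_Schwarz[OF hol h0 half] obtain \<phi>
    where \<phi>h: "\<phi> holomorphic_on ball 0 1" and \<phi>0: "\<phi> 0 = 0"
      and \<phi>b: "\<And>z. norm z < 1 \<Longrightarrow> norm (\<phi> z) < 1"
      and eq: "\<And>z. norm z < 1 \<Longrightarrow> deriv h z / h z = - (deriv \<phi> z / (1 + \<phi> z))" by blast
  have z1: "norm z < 1" using z by simp
  define r where "r = norm z"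
  define u where "u = 1 + \<phi> z"
  define t where "t = norm u"
  define x where "x = Re u"
  have r: "0 \<le> r" "r \<le> 1/3" using z by (auto simp: r_def)
  have m: "norm (\<phi> z) \<le> r"
    using Schwarz_Lemma(1)[OF \<phi>h \<phi>0 \<phi>b z1] by (simp add: r_def)
  have t1: "1 - r \<le> t" using norm_diff_ineq[of 1 "\<phi> z"] m by (simp add: t_def u_def)
  have t2: "t \<le> 1 + r" using norm_triangle_ineq[of 1 "\<phi> z"] m by (simp add: t_def u_def)
  have tp: "t > 0" using t1 r by linarith
  then have u0: "u \<noteq> 0" by (auto simp: t_def)
  have xt: "x \<le> t" by (simp add: x_def t_def complex_Re_le_cmod)
  have d0: "1 - r\<^sup>2 > 0" using z1 by (simp add: r_def abs_square_less_1)
  have nphi: "(norm (\<phi> z))\<^sup>2 = t\<^sup>2 - 2 * x + 1"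
    unfolding t_def x_def u_def cmod_power2 by (simp add: power2_eq_square algebra_simps)
  have Re1u: "Re (1 / u) = x / t\<^sup>2"
    by (simp add: Re_divide x_def t_def cmod_power2)
  have "Re (z * deriv \<phi> z / u) = Re (\<phi> z / u) + Re ((z * deriv \<phi> z - \<phi> z) / u)"
    by (simp add: diff_divide_distrib)
  also have "\<phi> z / u = 1 - 1 / u" using u0 by (simp add: u_def field_simps)
  also have "Re (1 - 1 / u) = 1 - x / t\<^sup>2" using Re1u by simp
  also have "Re ((z * deriv \<phi> z - \<phi> z) / u) \<le> norm (z * deriv \<phi> z - \<phi> z) / t"
    using complex_Re_le_cmod[of "(z * deriv \<phi> z - \<phi> z) / u"] by (simp add: norm_divide t_def)
  also have "\<dots> \<le> (r\<^sup>2 - (t\<^sup>2 - 2 * x + 1)) / (1 - r\<^sup>2) / t"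
    using Schwarz_function_deriv_defect[OF \<phi>h \<phi>0 \<phi>b z1] d0 tp
    by (intro divide_right_mono) (auto simp: pos_le_divide_eq nphi r_def)
  finally have A: "Re (z * deriv \<phi> z / u) \<le> 1 - x / t\<^sup>2 + (r\<^sup>2 - (t\<^sup>2 - 2 * x + 1)) / (1 - r\<^sup>2) / t"
    by simp
  also have "\<dots> \<le> 1 - t / t\<^sup>2 + (r\<^sup>2 - (t\<^sup>2 - 2 * t + 1)) / (1 - r\<^sup>2) / t"
  proof -
    have "1 - r\<^sup>2 \<le> 2 * t"
    proof -
      have "1 - r\<^sup>2 \<le> 2 * (1 - r)"
        using zero_le_power2[of "1 - r"] by (simp add: power2_diff)
      also have "\<dots> \<le> 2 * t" using t1 by simp
      finally show ?thesis .
    qed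
    then have "0 \<le> (t - x) * (2 * t - (1 - r\<^sup>2)) / (t\<^sup>2 * (1 - r\<^sup>2))"
      using xt d0 tp by (intro divide_nonneg_pos mult_nonneg_nonneg) auto
    also have "\<dots> = (1 - t / t\<^sup>2 + (r\<^sup>2 - (t\<^sup>2 - 2 * t + 1)) / (1 - r\<^sup>2) / t)
        - (1 - x / t\<^sup>2 + (r\<^sup>2 - (t\<^sup>2 - 2 * x + 1)) / (1 - r\<^sup>2) / t)"
    proof -
      \<comment> \<open>the identity is polynomial once the reciprocals \<open>a = 1 / t\<close> and \<open>d = 1 / D\<close> are treated as variables\<close>
      have "t * a = 1 \<Longrightarrow> D * d = 1 \<Longrightarrow> (t - x) * (2 * t - D) * (a\<^sup>2 * d)
        = (1 - t * a\<^sup>2 + (r\<^sup>2 - (t\<^sup>2 - 2 * t + 1)) * d * a)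
          - (1 - x * a\<^sup>2 + (r\<^sup>2 - (t\<^sup>2 - 2 * x + 1)) * d * a)" for a d D :: real
        by algebra
      from this[of "1 / t" "1 - r\<^sup>2" "1 / (1 - r\<^sup>2)"] show ?thesis
        using d0 tp by (simp add: power_divide)
    qed
    finally show ?thesis by simp
  qed
  also have "\<dots> \<le> r / (1 + r)"
  proof -
    \<comment> \<open>\<open>t \<le> 1 + r \<le> 2 (1 - r)\<close>; the last inequality is where \<open>r \<le> 1 / 3\<close> enters\<close>
    have "0 \<le> (1 + r - t) * (2 * (1 - r) - t) / (t * ((1 + r) * (1 - r)))"
      using t2 r tp by (intro divide_nonneg_pos mult_nonneg_nonneg mult_pos_pos) auto
    also have "\<dots> = r / (1 + r) - (1 - t / t\<^sup>2 + (r\<^sup>2 - (t\<^sup>2 - 2 * t + 1)) / ((1 + r) * (1 - r)) / t)"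
    proof -
      have "t * a = 1 \<Longrightarrow> (1 + r) * b = 1 \<Longrightarrow> (1 - r) * c = 1 \<Longrightarrow>
        (1 + r - t) * (2 * (1 - r) - t) * (a * b * c)
        = r * b - (1 - t * a\<^sup>2 + (r\<^sup>2 - (t\<^sup>2 - 2 * t + 1)) * (b * c) * a)" for a b c :: real
        by algebra
      from this[of "1 / t" "1 / (1 + r)" "1 / (1 - r)"] show ?thesis
        using r tp by (simp add: power_divide)
    qed
    also have "(1 + r) * (1 - r) = 1 - r\<^sup>2" by (simp add: power2_eq_square algebra_simps)
    finally show ?thesis by simp
  qed
  finally have "Re (z * deriv \<phi> z / u) \<le> r / (1 + r)" .
  moreover have "z * deriv h z / h z = - (z * deriv \<phi> z / u)"
    using eq[OF z1] by (metis mult_minus_right times_divide_eq_right u_def)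
  ultimately show ?thesis by (simp add: r_def)
qed

section \<open>Starlike functions are univalent\<close>

lemma log_quot_mult_id:
  assumes hol: "q holomorphic_on ball 0 1" and nz: "\<And>z. norm z < 1 \<Longrightarrow> q z \<noteq> 0"
    and eq: "\<And>z. norm z < 1 \<Longrightarrow> f z = z * q z" and z: "norm z < 1"
  shows "log_quot f z = 1 + z * deriv q z / q z"
proof (cases "z = 0")
  case True
  then show ?thesis by (simp add: log_quot_def nquot_def)
next
  case False
  have d: "(q has_field_derivative deriv q z) (at z)"
    using hol z by (intro holomorphic_derivI[of _ "ball 0 1"]) auto
  have "((\<lambda>v. v * q v) has_field_derivative q z + z * deriv q z) (at z)"
    by (rule derivative_eq_intros d refl | simp)+
  then have "(f has_field_derivative q z + z * deriv q z) (at z)"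
    by (rule has_field_derivative_transform_within_open[of _ _ _ "ball 0 1"]) (use z eq in auto)
  then have "deriv f z = q z + z * deriv q z" by (rule DERIV_imp_deriv)
  then show ?thesis using False nz[OF z] eq[OF z]
    by (simp add: log_quot_def nquot_def field_simps)
qed

text \<open>
  The value \<open>1\<close> at the origin removes the singularity because \<open>f'(0) = 1\<close>.
\<close>

lemma class_A_quotient_id:
  assumes "f \<in> class_A"
  shows "nquot f (\<lambda>w. w) holomorphic_on ball 0 1" "f z = z * nquot f (\<lambda>w. w) z"
proof -
  show "f z = z * nquot f (\<lambda>w. w) z" for z using assms by (simp add: nquot_def class_A_def)
  show "nquot f (\<lambda>w. w) holomorphic_on ball 0 1"
  proof (rule pole_theorem_open_0)
    show "f holomorphic_on ball 0 1" "f 0 = 0" "nquot f (\<lambda>w. w) 0 = deriv f 0"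
      using assms by (simp_all add: nquot_def class_A_def)
    show "f z = (z - 0) * nquot f (\<lambda>w. w) z" if "z \<in> ball 0 1 - {0}" for z
      using that by (simp add: nquot_def)
  qed simp
qed

text \<open>
  If \<open>f a = f b\<close>, the mean value theorem for the real part of \<open>f / (b - a)\<close> along the segment gives a
  point where \<open>Re f'\<close> vanishes.
\<close>

lemma Noshiro_Warschawski:
  assumes S: "convex S"
    and d: "\<And>z. z \<in> S \<Longrightarrow> (f has_field_derivative f' z) (at z)"
    and pos: "\<And>z. z \<in> S \<Longrightarrow> Re (f' z) > 0"
  shows "inj_on f S"
proof (rule inj_onI, rule ccontr)
  fix a b assume ab: "a \<in> S" "b \<in> S" "f a = f b" "a \<noteq> b"
  have "\<exists>u. u \<in> closed_segment a b \<and>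
      Re (f b / (b - a)) - Re (f a / (b - a)) = Re (f' u / (b - a) * (b - a))"
    using closed_segment_subset[OF ab(1,2) S] d
    by (intro complex_mvt_line) (auto intro!: DERIV_cdivide)
  then obtain u where "u \<in> closed_segment a b" "Re (f' u) = 0"
    using ab by auto
  then show False using pos closed_segment_subset[OF ab(1,2) S] by force
qed

text \<open>
  Write \<open>f z = z exp (L z)\<close>. On the left half-plane, \<open>F \<zeta> = \<zeta> + L (exp \<zeta>)\<close> is a logarithm of
  \<open>f (exp \<zeta>)\<close> whose derivative is \<open>z f' / f\<close> at \<open>z = exp \<zeta>\<close>, so \<open>F\<close> is injective. If \<open>f\<close> takes equal
  values at \<open>exp s\<close> and \<open>exp t\<close>, then \<open>F s\<close> and \<open>F t\<close> differ by a period of \<open>exp\<close>; as \<open>F\<close> commutes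
  with translation by periods, so do \<open>s\<close> and \<open>t\<close>.
\<close>

lemma starlike_imp_inj_on:
  assumes f: "f \<in> class_A" and nz: "\<And>z. z \<in> unit_disk - {0} \<Longrightarrow> f z \<noteq> 0"
    and pos: "\<And>z. z \<in> unit_disk \<Longrightarrow> Re (log_quot f z) > 0"
  shows "inj_on f unit_disk"
proof -
  define q where "q = nquot f (\<lambda>w. w)"
  have qh: "q holomorphic_on unit_disk" and fq: "\<And>z. f z = z * q z"
    using class_A_quotient_id[OF f] by (auto simp: q_def)
  have qnz: "q z \<noteq> 0" if "z \<in> unit_disk" for z
  proof (cases "z = 0")
    case True
    then show ?thesis by (simp add: q_def nquot_def)
  next
    case False
    then show ?thesis using nz[of z] fq[of z] that by force
  qed
  obtain L where Lh: "L holomorphic_on unit_disk" and L: "\<And>z. z \<in> unit_disk \<Longrightarrow> q z = exp (L z)"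
    using simply_connected_imp_holomorphic_log[OF qh convex_imp_simply_connected[OF convex_ball]
        convex_imp_locally_path_connected[OF convex_ball] qnz]
    by blast
  have dL: "(L has_field_derivative deriv L z) (at z)" if "norm z < 1" for z
    using Lh that by (intro holomorphic_derivI[of _ "ball 0 1"]) auto
  have lq: "log_quot f z = 1 + z * deriv L z" if z: "norm z < 1" for z
  proof -
    have "((\<lambda>v. exp (L v)) has_field_derivative exp (L z) * deriv L z) (at z)"
      by (rule derivative_eq_intros dL z refl)+
    then have "(q has_field_derivative exp (L z) * deriv L z) (at z)"
      by (rule has_field_derivative_transform_within_open[of _ _ _ "ball 0 1"]) (use z L in auto)
    then have "deriv q z = q z * deriv L z" using L[of z] z by (simp add: DERIV_imp_deriv)
    then show ?thesis using log_quot_mult_id[OF qh _ fq z] qnz z by simp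
  qed
  define H where "H = {\<zeta>::complex. Re \<zeta> < 0}"
  define F where "F = (\<lambda>\<zeta>. \<zeta> + L (exp \<zeta>))"
  have "inj_on F H"
  proof (rule Noshiro_Warschawski)
    show "convex H" unfolding H_def by (rule convex_halfspace_Re_lt)
    show "(F has_field_derivative log_quot f (exp \<zeta>)) (at \<zeta>)" if "\<zeta> \<in> H" for \<zeta>
    proof -
      have e: "norm (exp \<zeta>) < 1" using that by (simp add: H_def)
      have "((\<lambda>\<zeta>. L (exp \<zeta>)) has_field_derivative deriv L (exp \<zeta>) * exp \<zeta>) (at \<zeta>)"
        by (rule DERIV_chain2[OF dL[OF e] DERIV_exp])
      then show ?thesis unfolding F_def lq[OF e]
        by (auto intro!: derivative_eq_intros)
    qed
    show "Re (log_quot f (exp \<zeta>)) > 0" if "\<zeta> \<in> H" for \<zeta>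
      using pos that by (simp add: H_def)
  qed
  have f0: "f 0 = 0" using fq[of 0] by simp
  show ?thesis
  proof (rule inj_onI)
    fix a b assume ab: "a \<in> unit_disk" "b \<in> unit_disk" and fab: "f a = f b"
    show "a = b"
    proof (cases "a = 0 \<or> b = 0")
      case True
      then show ?thesis using nz ab fab f0 by (metis Diff_iff singletonD)
    next
      case False
      define s where "s = Ln a"
      define t where "t = Ln b"
      have st: "exp s = a" "exp t = b" using False by (auto simp: s_def t_def)
      have sH: "s \<in> H" and tH: "t \<in> H" using ab False by (auto simp: s_def t_def H_def)
      have eF: "exp (F \<zeta>) = f (exp \<zeta>)" if "\<zeta> \<in> H" for \<zeta>
        using L[of "exp \<zeta>"] fq[of "exp \<zeta>"] that by (simp add: F_def H_def exp_add)
      have "exp (F s) = exp (F t)" using eF sH tH st fab by simp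
      then obtain n :: int where n: "F s = F t + of_int (2 * n) * of_real pi * \<i>"
        unfolding exp_eq by auto
      \<comment> \<open>\<open>t'\<close> is the logarithm of \<open>b\<close> for which \<open>F t'\<close> hits \<open>F s\<close>\<close>
      define t' where "t' = t + of_int (2 * n) * of_real pi * \<i>"
      have e': "exp t' = exp t" unfolding exp_eq t'_def by (intro exI[of _ n]) simp
      have "F t' = F s" using n e' by (simp add: F_def) (simp add: t'_def)
      moreover have "t' \<in> H" using tH by (simp add: H_def t'_def)
      ultimately have "t' = s" using \<open>inj_on F H\<close> sH by (auto dest: inj_onD)
      then show ?thesis using e' st by simp
    qed
  qed
qed

section \<open>Growth estimates for the family\<close>

text \<open>
  Here \<open>p\<close> is \<open>f / g\<close> and \<open>h\<close> is \<open>g z / z\<close>, both continued to the origin.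
\<close>

lemma F2_log_quot_decomposition:
  assumes f: "f \<in> F2_class"
  obtains p h where
    "p holomorphic_on unit_disk" "\<And>z. norm z < 1 \<Longrightarrow> Re (p z) > 0"
    "h holomorphic_on unit_disk" "h 0 = 1" "\<And>z. norm z < 1 \<Longrightarrow> Re (h z) > 1 / 2"
    "\<And>z. norm z < 1 \<Longrightarrow> f z = z * (p z * h z)"
    "\<And>z. norm z < 1 \<Longrightarrow> log_quot f z = 1 + z * deriv p z / p z + z * deriv h z / h z"
proof -
  from f obtain g where fA: "f \<in> class_A" and gA: "g \<in> class_A"
    and hg: "\<And>z. z \<in> unit_disk \<Longrightarrow> Re (nquot g (\<lambda>w. w) z) > 1 / 2"
    and pg: "\<And>z. z \<in> unit_disk \<Longrightarrow> Re (nquot f g z) > 0"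
    by (auto simp: F2_class_def)
  define h where "h = nquot g (\<lambda>w. w)"
  define p where "p = nquot f g"
  define q where "q = nquot f (\<lambda>w. w)"
  have hh: "h holomorphic_on unit_disk" and qh: "q holomorphic_on unit_disk"
    unfolding h_def q_def using class_A_quotient_id(1) fA gA by auto
  have hpos: "Re (h z) > 1 / 2" and ppos: "Re (p z) > 0" if "norm z < 1" for z
    using hg[of z] pg[of z] that by (simp_all add: h_def p_def)
  have hnz: "h z \<noteq> 0" and pnz: "p z \<noteq> 0" if "norm z < 1" for z
    using hpos[OF that] ppos[OF that] by auto
  have pq: "p z = q z / h z" for z
    by (simp add: p_def q_def h_def nquot_def)
  then have qph: "q z = p z * h z" if "norm z < 1" for z using hnz[OF that] by simp
  have "(\<lambda>z. q z / h z) holomorphic_on unit_disk"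
    using hnz by (intro holomorphic_intros qh hh) auto
  then have ph: "p holomorphic_on unit_disk" by (simp add: pq cong: holomorphic_cong)
  have feq: "f z = z * (p z * h z)" if "norm z < 1" for z
    using class_A_quotient_id(2)[OF fA, of z] qph[OF that] by (simp add: q_def)
  have lq: "log_quot f z = 1 + z * deriv p z / p z + z * deriv h z / h z" if z: "norm z < 1" for z
  proof -
    have "log_quot f z = 1 + z * deriv (\<lambda>z. p z * h z) z / (p z * h z)"
      using hnz pnz feq z by (intro log_quot_mult_id holomorphic_intros ph hh) auto
    moreover have "deriv (\<lambda>z. p z * h z) z = p z * deriv h z + deriv p z * h z"
      using ph hh z by (intro complex_derivative_mult_at holomorphic_on_imp_analytic_at
          holomorphic_on_imp_analytic_at[of _ unit_disk]) auto
    ultimately show ?thesis using hnz[OF z] pnz[OF z] by (simp add: field_simps)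
  qed
  show ?thesis
    by (rule that[OF ph ppos hh _ hpos feq lq]) (simp_all add: h_def nquot_def)
qed

lemma F2_nonzero:
  assumes "f \<in> F2_class" "z \<in> unit_disk - {0}" shows "f z \<noteq> 0"
proof -
  obtain p h where "Re (p z) > 0" "Re (h z) > 1 / 2" "f z = z * (p z * h z)"
    using F2_log_quot_decomposition[OF assms(1)] assms(2) by (metis DiffD1 mem_ball_0)
  then show ?thesis using assms(2) by auto
qed

lemma F2_norm_log_quot_minus_1:
  assumes f: "f \<in> F2_class" and z: "norm z < 1"
  shows "norm (log_quot f z - 1) \<le> 2 * norm z / (1 - (norm z)\<^sup>2) + norm z / (1 - norm z)"
proof -
  obtain p h where *: "p holomorphic_on unit_disk" "\<And>z. norm z < 1 \<Longrightarrow> Re (p z) > 0"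
    "h holomorphic_on unit_disk" "h 0 = 1" "\<And>z. norm z < 1 \<Longrightarrow> Re (h z) > 1 / 2"
    and "\<And>z. norm z < 1 \<Longrightarrow> f z = z * (p z * h z)"
    and lq: "\<And>z. norm z < 1 \<Longrightarrow> log_quot f z = 1 + z * deriv p z / p z + z * deriv h z / h z"
    by (rule F2_log_quot_decomposition[OF f]) (rule that; assumption)
  have "norm (log_quot f z - 1) = norm (z * deriv p z / p z + z * deriv h z / h z)"
    by (simp add: lq[OF z])
  also have "\<dots> \<le> norm (z * deriv p z / p z) + norm (z * deriv h z / h z)"
    by (rule norm_triangle_ineq)
  also have "\<dots> \<le> 2 * norm z / (1 - (norm z)\<^sup>2) + norm z / (1 - norm z)"
    by (intro add_mono log_deriv_bound_pos_Re log_deriv_bound_half_plane * z)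
  finally show ?thesis .
qed

lemma F2_Re_log_quot:
  assumes f: "f \<in> F2_class" and z: "norm z \<le> 1 / 3"
  shows "Re (log_quot f z) \<ge> 1 - 2 * norm z / (1 - (norm z)\<^sup>2) - norm z / (1 + norm z)"
proof -
  obtain p h where *: "p holomorphic_on unit_disk" "\<And>z. norm z < 1 \<Longrightarrow> Re (p z) > 0"
    "h holomorphic_on unit_disk" "h 0 = 1" "\<And>z. norm z < 1 \<Longrightarrow> Re (h z) > 1 / 2"
    and "\<And>z. norm z < 1 \<Longrightarrow> f z = z * (p z * h z)"
    and lq: "\<And>z. norm z < 1 \<Longrightarrow> log_quot f z = 1 + z * deriv p z / p z + z * deriv h z / h z"
    by (rule F2_log_quot_decomposition[OF f]) (rule that; assumption)
  have z1: "norm z < 1" using z by simp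
  have "- Re (z * deriv p z / p z) \<le> norm (z * deriv p z / p z)"
    using abs_Re_le_cmod[of "z * deriv p z / p z"] by linarith
  also have "\<dots> \<le> 2 * norm z / (1 - (norm z)\<^sup>2)"
    by (intro log_deriv_bound_pos_Re * z1)
  finally have "Re (z * deriv p z / p z) \<ge> - (2 * norm z / (1 - (norm z)\<^sup>2))" by simp
  moreover have "Re (z * deriv h z / h z) \<ge> - (norm z / (1 + norm z))"
    by (intro Re_log_deriv_bound_half_plane * z)
  ultimately show ?thesis by (simp add: lq[OF z1])
qed

text \<open>
  The bounds of the two preceding lemmas over the common denominator \<open>1 - r\<^sup>2\<close>.
\<close>

lemma F2_growth_fractions:
  fixes r :: real assumes "0 \<le> r" "r < 1"
  shows "2 * r / (1 - r\<^sup>2) + r / (1 - r) = (3 * r + r\<^sup>2) / (1 - r\<^sup>2)"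
    and "1 - 2 * r / (1 - r\<^sup>2) - r / (1 + r) = (1 - 3 * r) / (1 - r\<^sup>2)"
proof -
  have e: "1 - r\<^sup>2 = (1 - r) * (1 + r)" by (simp add: power2_eq_square algebra_simps)
  have nz: "1 - r \<noteq> 0" "1 + r \<noteq> 0" "1 - r\<^sup>2 \<noteq> 0" using assms by (auto simp: e)
  have a: "r / (1 - r) = r * (1 + r) / (1 - r\<^sup>2)" and b: "r / (1 + r) = r * (1 - r) / (1 - r\<^sup>2)"
    using nz by (simp_all add: e)
  have c: "1 = (1 - r\<^sup>2) / (1 - r\<^sup>2)" using nz by simp
  show "2 * r / (1 - r\<^sup>2) + r / (1 - r) = (3 * r + r\<^sup>2) / (1 - r\<^sup>2)"
    unfolding a add_divide_distrib[symmetric] by (simp add: power2_eq_square algebra_simps)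
  have "1 - 2 * r / (1 - r\<^sup>2) - r / (1 + r) = (1 - r\<^sup>2) / (1 - r\<^sup>2) - 2 * r / (1 - r\<^sup>2) - r * (1 - r) / (1 - r\<^sup>2)"
    using b c by simp
  also have "\<dots> = (1 - 3 * r) / (1 - r\<^sup>2)"
    unfolding diff_divide_distrib[symmetric] by (simp add: power2_eq_square algebra_simps)
  finally show "1 - 2 * r / (1 - r\<^sup>2) - r / (1 + r) = (1 - 3 * r) / (1 - r\<^sup>2)" .
qed

section \<open>The extremal function\<close>

lemma class_A_mult_id:
  assumes "q holomorphic_on unit_disk" "q 0 = 1"
  shows "(\<lambda>z. z * q z) \<in> class_A"
proof -
  have d: "(q has_field_derivative deriv q 0) (at 0)"
    using assms by (intro holomorphic_derivI[of _ unit_disk]) auto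
  have "((\<lambda>z. z * q z) has_field_derivative 1) (at 0)"
    by (auto intro!: derivative_eq_intros d simp: assms)
  then show ?thesis
    using assms by (auto simp: class_A_def intro!: holomorphic_intros DERIV_imp_deriv)
qed

definition extremal :: "complex \<Rightarrow> complex" where
  "extremal z = z * ((1 + z) / (1 - z)\<^sup>2)"

text \<open>
  The witness is \<open>g z = z / (1 - z)\<close>: here \<open>g z / z = 1 / (1 - z)\<close> maps the disk onto the half-plane
  \<open>Re w > 1 / 2\<close>, and \<open>f / g = 2 / (1 - z) - 1\<close> maps it onto the right half-plane.
\<close>

lemma extremal_in_F2: "extremal \<in> F2_class"
proof -
  define g where "g = (\<lambda>z::complex. z * (1 / (1 - z)))"
  have nz: "1 - z \<noteq> 0" if "norm z < 1" for z :: complex using that by auto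
  have kA: "extremal \<in> class_A"
    unfolding extremal_def[abs_def] using nz by (intro class_A_mult_id holomorphic_intros) auto
  have gA: "g \<in> class_A"
    unfolding g_def using nz by (intro class_A_mult_id holomorphic_intros) auto
  have half: "Re (1 / (1 - z)) > 1 / 2" if "norm z < 1" for z :: complex
    using norm_inverse_minus_1_less_1_iff[of "1 / (1 - z)"] nz[OF that] that by simp
  have 1: "nquot g (\<lambda>w. w) z = 1 / (1 - z)" for z by (simp add: nquot_def g_def)
  have 2: "nquot extremal g z = 2 * (1 / (1 - z)) - 1" if "norm z < 1" for z
  proof -
    have "nquot extremal g z = (1 + z) / (1 - z)"
      using nz[OF that] by (simp add: nquot_def extremal_def g_def power2_eq_square)
    also have "\<dots> = 2 * (1 / (1 - z)) - 1" using nz[OF that] by (simp add: field_simps)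
    finally show ?thesis .
  qed
  have "Re (nquot extremal g z) > 0" if "norm z < 1" for z
  proof -
    have "Re (2 * v - 1) > 0" if "Re v > 1 / 2" for v :: complex using that by simp
    from this[OF half[OF that]] show ?thesis unfolding 2[OF that] .
  qed
  then have "\<forall>z\<in>unit_disk. Re (nquot extremal g z) > 0" by simp
  moreover have "\<forall>z\<in>unit_disk. Re (nquot g (\<lambda>w. w) z) > 1 / 2"
    unfolding 1 using half by (metis mem_ball_0)
  ultimately show ?thesis unfolding F2_class_def using kA gA by blast
qed

lemma log_quot_extremal:
  assumes z: "norm z < 1" shows "log_quot extremal z = (1 + 3 * z) / (1 - z\<^sup>2)"
proof -
  define q where "q = (\<lambda>z::complex. (1 + z) / (1 - z)\<^sup>2)"
  have nz: "1 - z \<noteq> 0" "1 + z \<noteq> 0" if "norm z < 1" for z :: complex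
  proof -
    show "1 - z \<noteq> 0" using that by auto
    have "z \<noteq> - 1" using that by auto
    then show "1 + z \<noteq> 0" by (metis add.commute eq_neg_iff_add_eq_0)
  qed
  have "log_quot extremal z = 1 + z * deriv q z / q z"
    using nz z by (intro log_quot_mult_id) (auto simp: q_def extremal_def intro!: holomorphic_intros)
  moreover have "(q has_field_derivative (3 + z) / (1 - z) ^ 3) (at z)"
  proof -
    have "(q has_field_derivative ((0 + 1) * (1 - z)\<^sup>2 - (1 + z) * (of_nat 2 * (0 - 1) * (1 - z) ^ (2 - 1)))
        / ((1 - z)\<^sup>2 * (1 - z)\<^sup>2)) (at z)"
      unfolding q_def using nz(1)[OF z] by (auto intro!: derivative_eq_intros)
    also have "((0 + 1) * (1 - z)\<^sup>2 - (1 + z) * (of_nat 2 * (0 - 1) * (1 - z) ^ (2 - 1)))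
        = (3 + z) * (1 - z)" by (simp add: power2_eq_square algebra_simps)
    also have "(3 + z) * (1 - z) / ((1 - z)\<^sup>2 * (1 - z)\<^sup>2) = (3 + z) / (1 - z) ^ 3"
      using nz(1)[OF z] by (simp add: power2_eq_square power3_eq_cube)
    finally show ?thesis .
  qed
  then have "deriv q z = (3 + z) / (1 - z) ^ 3" by (rule DERIV_imp_deriv)
  moreover have "z * ((3 + z) / (1 - z) ^ 3) / ((1 + z) / (1 - z)\<^sup>2) = z * (3 + z) / ((1 - z) * (1 + z))"
    using nz[OF z] by (simp add: power2_eq_square power3_eq_cube)
  moreover have "(1 - z) * (1 + z) = 1 - z\<^sup>2" by (simp add: power2_eq_square algebra_simps)
  moreover have "1 + z * (3 + z) / (1 - z\<^sup>2) = (1 + 3 * z) / (1 - z\<^sup>2)"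
  proof -
    have "1 - z\<^sup>2 \<noteq> 0" using nz[OF z] \<open>(1 - z) * (1 + z) = 1 - z\<^sup>2\<close> by (metis mult_eq_0_iff)
    then have "1 + z * (3 + z) / (1 - z\<^sup>2) = ((1 - z\<^sup>2) + z * (3 + z)) / (1 - z\<^sup>2)"
      by (simp add: add_divide_distrib)
    also have "(1 - z\<^sup>2) + z * (3 + z) = 1 + 3 * z" by (simp add: power2_eq_square algebra_simps)
    finally show ?thesis .
  qed
  ultimately show ?thesis by (simp add: q_def)
qed

lemma log_quot_extremal_real:
  assumes "\<bar>x\<bar> < 1"
  shows "log_quot extremal (of_real x) = of_real ((1 + 3 * x) / (1 - x\<^sup>2))"
  using assms by (simp add: log_quot_extremal)

section \<open>Radii of the family as pointwise conditions\<close>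

lemma dilation:
  fixes r :: real
  assumes f: "f \<in> class_A" and r: "0 < r" "r \<le> 1"
  defines "F \<equiv> \<lambda>z. f (of_real r * z) / of_real r"
  shows "F \<in> class_A" and "z \<in> unit_disk \<Longrightarrow> log_quot F z = log_quot f (of_real r * z)"
proof -
  have in_disk: "of_real r * z \<in> unit_disk" if "z \<in> unit_disk" for z :: complex
  proof -
    have "r * norm z \<le> 1 * norm z" using r by (intro mult_right_mono) auto
    then show ?thesis using r that by (simp add: norm_mult)
  qed
  have d: "(F has_field_derivative deriv f (of_real r * z)) (at z)" if z: "z \<in> unit_disk" for z
  proof -
    have "(f has_field_derivative deriv f (of_real r * z)) (at (of_real r * z))"
      using f in_disk[OF z] by (intro holomorphic_derivI[of _ unit_disk]) (auto simp: class_A_def)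
    then have "((\<lambda>z. f (of_real r * z)) has_field_derivative deriv f (of_real r * z) * of_real r) (at z)"
      by (rule DERIV_chain2) (auto intro!: derivative_eq_intros)
    from DERIV_cdivide[OF this, of "of_real r"] show ?thesis using r by (simp add: F_def)
  qed
  have "F holomorphic_on unit_disk"
    unfolding holomorphic_on_open[OF open_ball] using d by blast
  moreover have "deriv F 0 = 1" using d[of 0] f by (simp add: DERIV_imp_deriv class_A_def)
  moreover have "F 0 = 0" using f by (simp add: F_def class_A_def)
  ultimately show "F \<in> class_A" by (simp add: class_A_def)
  show "log_quot F z = log_quot f (of_real r * z)" if z: "z \<in> unit_disk"
    using r DERIV_imp_deriv[OF d[OF z]] by (simp add: log_quot_def nquot_def F_def)
qed

text \<open>
  Univalence and the various side conditions in the definitions of the classes are absorbed here, so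
  that the radius arguments need only the set of allowed values of \<open>z f' / f\<close>.
\<close>

definition has_log_quot_region :: "(complex \<Rightarrow> complex) set \<Rightarrow> complex set \<Rightarrow> bool" where
  "has_log_quot_region G W \<longleftrightarrow>
     (\<forall>f\<in>class_A. (\<forall>z\<in>unit_disk - {0}. f z \<noteq> 0) \<longrightarrow>
        (f \<in> G \<longleftrightarrow> (\<forall>z\<in>unit_disk. log_quot f z \<in> W)))"

text \<open>
  Dilation by \<open>r\<close> turns the values of \<open>z f' / f\<close> on the disk of radius \<open>r\<close> into those on the unit disk,
  so admissibility is a pointwise condition on \<open>ball 0 R\<close>. Members of the family vanish only at
  the origin, which is what makes the region describe membership.
\<close>

lemma admissible_radii_F2_iff:
  assumes G: "has_log_quot_region G W"
  shows "R \<in> admissible_radii G F2_class \<longleftrightarrow>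
    0 \<le> R \<and> R \<le> 1 \<and> (\<forall>f\<in>F2_class. \<forall>\<zeta>\<in>ball 0 R. log_quot f \<zeta> \<in> W)"
proof -
  have dil: "(\<lambda>z. f (of_real r * z) / of_real r) \<in> G \<longleftrightarrow> (\<forall>\<zeta>\<in>ball 0 r. log_quot f \<zeta> \<in> W)"
    if f: "f \<in> F2_class" and r: "0 < r" "r \<le> 1" for f r
  proof -
    define F where "F = (\<lambda>z. f (of_real r * z) / of_real r)"
    have fA: "f \<in> class_A" using f by (simp add: F2_class_def)
    have "F z \<noteq> 0" if z: "z \<in> unit_disk - {0}" for z
    proof -
      have "r * norm z \<le> 1 * norm z" using r by (intro mult_right_mono) auto
      also have "\<dots> < 1" using z by simp
      finally have "of_real r * z \<in> unit_disk - {0}" using z r by (simp add: norm_mult)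
      then show ?thesis using F2_nonzero[OF f] r by (simp add: F_def)
    qed
    moreover have "F \<in> class_A" unfolding F_def by (rule dilation(1)[OF fA r])
    ultimately have "F \<in> G \<longleftrightarrow> (\<forall>z\<in>unit_disk. log_quot F z \<in> W)"
      using G unfolding has_log_quot_region_def by simp
    also have "\<dots> \<longleftrightarrow> (\<forall>z\<in>unit_disk. log_quot f (of_real r * z) \<in> W)"
      using dilation(2)[OF fA r] by (simp add: F_def)
    also have "\<dots> \<longleftrightarrow> (\<forall>\<zeta>\<in>ball 0 r. log_quot f \<zeta> \<in> W)"
    proof (intro iffI ballI)
      fix \<zeta> :: complex assume *: "\<forall>z\<in>unit_disk. log_quot f (of_real r * z) \<in> W" and \<zeta>: "\<zeta> \<in> ball 0 r"
      have "\<zeta> / of_real r \<in> unit_disk" using \<zeta> r by (simp add: norm_divide)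
      from bspec[OF * this] show "log_quot f \<zeta> \<in> W" using r by simp
    next
      fix z :: complex assume *: "\<forall>\<zeta>\<in>ball 0 r. log_quot f \<zeta> \<in> W" and z: "z \<in> unit_disk"
      have "of_real r * z \<in> ball 0 r" using z r by (simp add: norm_mult)
      from bspec[OF * this] show "log_quot f (of_real r * z) \<in> W" .
    qed
    finally show ?thesis by (simp add: F_def)
  qed
  have "(\<forall>r. 0 < r \<and> r \<le> R \<longrightarrow> (\<forall>f\<in>F2_class. (\<lambda>z. f (of_real r * z) / of_real r) \<in> G)) \<longleftrightarrow>
      (\<forall>f\<in>F2_class. \<forall>\<zeta>\<in>ball 0 R. log_quot f \<zeta> \<in> W)" if R: "0 \<le> R" "R \<le> 1"
  proof (cases "R = 0")
    case False
    have "(\<forall>r. 0 < r \<and> r \<le> R \<longrightarrow> (\<forall>f\<in>F2_class. (\<lambda>z. f (of_real r * z) / of_real r) \<in> G)) \<longleftrightarrow>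
        (\<forall>r. 0 < r \<and> r \<le> R \<longrightarrow> (\<forall>f\<in>F2_class. \<forall>\<zeta>\<in>ball 0 r. log_quot f \<zeta> \<in> W))"
      using R by (intro all_cong ball_cong dil) auto
    also have "\<dots> \<longleftrightarrow> (\<forall>f\<in>F2_class. \<forall>\<zeta>\<in>ball 0 R. log_quot f \<zeta> \<in> W)"
    proof (intro iffI allI impI)
      assume *: "\<forall>r. 0 < r \<and> r \<le> R \<longrightarrow> (\<forall>f\<in>F2_class. \<forall>\<zeta>\<in>ball 0 r. log_quot f \<zeta> \<in> W)"
      have "0 < R" using R False by simp
      with *[THEN spec, of R] show "\<forall>f\<in>F2_class. \<forall>\<zeta>\<in>ball 0 R. log_quot f \<zeta> \<in> W" by simp
    next
      fix r assume *: "\<forall>f\<in>F2_class. \<forall>\<zeta>\<in>ball 0 R. log_quot f \<zeta> \<in> W" and "0 < r \<and> r \<le> R"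
      then have "ball 0 r \<subseteq> ball (0::complex) R" by (intro subset_ball) simp
      with * show "\<forall>f\<in>F2_class. \<forall>\<zeta>\<in>ball 0 r. log_quot f \<zeta> \<in> W" by (meson subsetD)
    qed
    finally show ?thesis .
  qed auto
  then show ?thesis by (auto simp: admissible_radii_def)
qed

lemma is_radius_F2I:
  assumes G: "has_log_quot_region G W" and R: "0 < R" "R < 1"
    and inside: "\<And>f \<zeta>. f \<in> F2_class \<Longrightarrow> norm \<zeta> < R \<Longrightarrow> log_quot f \<zeta> \<in> W"
    and f: "f \<in> F2_class"
    and sharp: "\<And>\<rho>. R < \<rho> \<Longrightarrow> \<rho> < 1 \<Longrightarrow> \<exists>\<zeta>. norm \<zeta> = \<rho> \<and> log_quot f \<zeta> \<notin> W"
  shows "is_radius G F2_class R"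
  unfolding is_radius_def
proof (intro conjI ballI)
  show "R \<in> admissible_radii G F2_class"
    unfolding admissible_radii_F2_iff[OF G] using R inside by auto
  fix R' assume "R' \<in> admissible_radii G F2_class"
  then have R': "R' \<le> 1" "\<And>\<zeta>. norm \<zeta> < R' \<Longrightarrow> log_quot f \<zeta> \<in> W"
    unfolding admissible_radii_F2_iff[OF G] using f by auto
  show "R' \<le> R"
  proof (rule ccontr)
    assume "\<not> R' \<le> R"
    then obtain \<rho> where "R < \<rho>" "\<rho> < R'" using dense not_le by metis
    then show False using sharp[of \<rho>] R' by fastforce
  qed
qed

text \<open>
  The supremum is itself admissible because an open ball is the union of the smaller balls with the
  same centre.
\<close>

lemma is_radius_F2_Sup:
  assumes G: "has_log_quot_region G W"
  shows "is_radius G F2_class (Sup (admissible_radii G F2_class))"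
proof -
  let ?S = "admissible_radii G F2_class"
  have ne: "0 \<in> ?S" unfolding admissible_radii_F2_iff[OF G] by simp
  have bdd: "bdd_above ?S" using admissible_radii_F2_iff[OF G] by (intro bdd_aboveI[of _ 1]) auto
  have le: "R \<le> Sup ?S" if "R \<in> ?S" for R using that bdd by (rule cSup_upper)
  have "Sup ?S \<in> ?S"
    unfolding admissible_radii_F2_iff[OF G]
  proof (intro conjI ballI)
    show "0 \<le> Sup ?S" using le[OF ne] .
    show "Sup ?S \<le> 1"
    proof (rule cSup_least)
      show "?S \<noteq> {}" using ne by blast
    qed (simp add: admissible_radii_F2_iff[OF G])
    fix f \<zeta> assume f: "f \<in> F2_class" and "\<zeta> \<in> ball (0::complex) (Sup ?S)"
    then have "norm \<zeta> < Sup ?S" by simp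
    then obtain R where "R \<in> ?S" "norm \<zeta> < R" using ne by (auto elim!: less_cSupE)
    then show "log_quot f \<zeta> \<in> W" using f unfolding admissible_radii_F2_iff[OF G] by simp
  qed
  then show ?thesis using le by (simp add: is_radius_def)
qed

lemma lemniscate_region:
  "has_log_quot_region lemniscate_class {w. norm (w\<^sup>2 - 1) < 1 \<and> Re w > 0}"
  by (auto simp: has_log_quot_region_def lemniscate_class_def)

lemma M_region: "has_log_quot_region (M_class \<beta>) {w. Re w < \<beta>}"
  by (auto simp: has_log_quot_region_def M_class_def)

text \<open>
  Membership also asks for univalence, which the half-plane condition supplies.
\<close>

lemma starlike_region:
  assumes "0 \<le> \<alpha>" shows "has_log_quot_region (starlike_class \<alpha>) {w. Re w > \<alpha>}"
proof -
  have "inj_on f unit_disk" if "f \<in> class_A" "\<forall>z\<in>unit_disk - {0}. f z \<noteq> 0"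
    "\<forall>z\<in>unit_disk. Re (log_quot f z) > \<alpha>" for f
    using that assms by (intro starlike_imp_inj_on) (auto intro: le_less_trans)
  then show ?thesis
    by (auto simp: has_log_quot_region_def starlike_class_def class_S_def)
qed

lemma parabolic_region: "has_log_quot_region parabolic_class {w. Re w > norm (w - 1)}"
  by (auto simp: has_log_quot_region_def parabolic_class_def)

section \<open>The four radii\<close>

text \<open>
  This is the quadratic formula with its numerator rationalised; if \<open>a < 0\<close> it gives the smaller of
  the two positive roots, and it covers \<open>a = 0\<close>, which occurs for starlikeness of order \<open>0\<close>.
\<close>

lemma quadratic_root:
  fixes a c :: real
  assumes c: "c > 0" and disc: "9 + 4 * a * c \<ge> 0"
  defines "R \<equiv> 2 * c / (3 + sqrt (9 + 4 * a * c))"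
  shows "R > 0" "a * R\<^sup>2 + 3 * R = c"
proof -
  define s where "s = sqrt (9 + 4 * a * c)"
  have s: "s \<ge> 0" "s\<^sup>2 = 9 + 4 * a * c" using disc by (auto simp: s_def)
  have R: "R * (3 + s) = 2 * c" using s by (simp add: R_def s_def[symmetric])
  show "R > 0" using s c by (simp add: R_def s_def[symmetric])
  have "4 * c * (a * R\<^sup>2 + 3 * R - c) = 0"
    using R s(2) by algebra
  then show "a * R\<^sup>2 + 3 * R = c" using c by simp
qed

text \<open>
  Together with the root this decides on which side of \<open>R\<close> a point of the unit interval lies. The
  hypothesis on \<open>a\<close> admits both \<open>a = \<beta>\<close> and \<open>a = - \<alpha>\<close>.
\<close>

lemma quadratic_strict_mono:
  fixes a s t :: real
  assumes "a \<ge> - 1" "0 \<le> s" "s < t" "t \<le> 1"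
  shows "a * s\<^sup>2 + 3 * s < a * t\<^sup>2 + 3 * t"
proof -
  have "- 1 * (t + s) \<le> a * (t + s)" using assms by (intro mult_right_mono) auto
  then have "0 < (t - s) * (3 + a * (t + s))" using assms by (intro mult_pos_pos) auto
  also have "\<dots> = (a * t\<^sup>2 + 3 * t) - (a * s\<^sup>2 + 3 * s)" by (simp add: power2_eq_square algebra_simps)
  finally show ?thesis by simp
qed

text \<open>
  Everything that the \<open>M_class \<beta>\<close> and the lemniscate results share. The estimate inside the
  radius is on the full distance to \<open>1\<close>, more than \<open>M_class \<beta>\<close> asks for, because the lemniscate
  condition is two-dimensional.
\<close>

lemma M_radius:
  fixes \<beta> :: real
  assumes \<beta>: "\<beta> > 1"
  defines "R \<equiv> 2 * (\<beta> - 1) / (3 + sqrt (9 + 4 * \<beta> * (\<beta> - 1)))"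
  shows "0 < R" "R < 1"
    and "f \<in> F2_class \<Longrightarrow> norm z < R \<Longrightarrow> norm (log_quot f z - 1) < \<beta> - 1"
    and "R < \<rho> \<Longrightarrow> \<rho> < 1 \<Longrightarrow> (1 + 3 * \<rho>) / (1 - \<rho>\<^sup>2) > \<beta>"
proof -
  have disc: "9 + 4 * \<beta> * (\<beta> - 1) \<ge> 0" using \<beta> by simp
  show R0: "0 < R" using quadratic_root(1)[OF _ disc] \<beta> by (simp add: R_def)
  have eq: "\<beta> * R\<^sup>2 + 3 * R = \<beta> - 1"
    using quadratic_root(2)[OF _ disc] \<beta> by (simp add: R_def)
  show R1: "R < 1"
  proof (rule ccontr)
    assume "\<not> R < 1"
    then have "\<beta> * 1 \<le> \<beta> * R\<^sup>2" "1 \<le> R" using \<beta> by (auto intro!: mult_left_mono simp: one_le_power)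
    then show False using eq by linarith
  qed
  show "norm (log_quot f z - 1) < \<beta> - 1" if f: "f \<in> F2_class" and z: "norm z < R"
  proof -
    have z1: "norm z < 1" using z R1 by simp
    then have d: "1 - (norm z)\<^sup>2 > 0" by (simp add: abs_square_less_1)
    have "norm (log_quot f z - 1) \<le> (3 * norm z + (norm z)\<^sup>2) / (1 - (norm z)\<^sup>2)"
      using F2_norm_log_quot_minus_1[OF f z1] F2_growth_fractions(1)[of "norm z"] z1 by simp
    also have "\<dots> < \<beta> - 1"
    proof -
      have "\<beta> * (norm z)\<^sup>2 + 3 * norm z < \<beta> - 1"
        using quadratic_strict_mono[of \<beta> "norm z" R] \<beta> z R1 eq by simp
      then show ?thesis by (subst pos_divide_less_eq[OF d]) (simp add: algebra_simps)
    qed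
    finally show ?thesis .
  qed
  show "(1 + 3 * \<rho>) / (1 - \<rho>\<^sup>2) > \<beta>" if \<rho>: "R < \<rho>" "\<rho> < 1"
  proof -
    have d: "1 - \<rho>\<^sup>2 > 0" using \<rho> R0 by (simp add: abs_square_less_1)
    have "\<beta> - 1 < \<beta> * \<rho>\<^sup>2 + 3 * \<rho>"
      using quadratic_strict_mono[of \<beta> R \<rho>] \<beta> \<rho> R0 eq by simp
    then show ?thesis by (subst pos_less_divide_eq[OF d]) (simp add: algebra_simps)
  qed
qed

lemma is_radius_M:
  assumes \<beta>: "\<beta> > 1"
  shows "is_radius (M_class \<beta>) F2_class (2 * (\<beta> - 1) / (3 + sqrt (9 + 4 * \<beta> * (\<beta> - 1))))"
proof (rule is_radius_F2I[OF M_region M_radius(1,2)[OF \<beta>] _ extremal_in_F2])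
  fix f and z :: complex assume "f \<in> F2_class" "norm z < 2 * (\<beta> - 1) / (3 + sqrt (9 + 4 * \<beta> * (\<beta> - 1)))"
  from M_radius(3)[OF \<beta> this] have "Re (log_quot f z - 1) < \<beta> - 1"
    by (rule le_less_trans[OF complex_Re_le_cmod])
  then show "log_quot f z \<in> {w. Re w < \<beta>}" by simp
next
  fix \<rho> assume \<rho>: "2 * (\<beta> - 1) / (3 + sqrt (9 + 4 * \<beta> * (\<beta> - 1))) < \<rho>" "\<rho> < 1"
  have "\<rho> > 0" using M_radius(1)[OF \<beta>] \<rho> by linarith
  then show "\<exists>\<zeta>. norm \<zeta> = \<rho> \<and> log_quot extremal \<zeta> \<notin> {w. Re w < \<beta>}"
    using M_radius(4)[OF \<beta> \<rho>] \<rho>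
    by (intro exI[of _ "of_real \<rho>"]) (simp add: log_quot_extremal_real del: of_real_divide)
qed

text \<open>
  This is the case \<open>\<beta> = sqrt 2\<close>: if \<open>|w - 1| < sqrt 2 - 1\<close> then \<open>|w + 1| < sqrt 2 + 1\<close>, and the product
  of the two bounds is \<open>1\<close>.
\<close>

lemma is_radius_lemniscate:
  "is_radius lemniscate_class F2_class
     ((4 - 2 * sqrt 2) / (sqrt 2 * (sqrt (17 - 4 * sqrt 2) + 3)))"
proof -
  have \<beta>: "sqrt 2 > 1" by simp
  have "9 + 4 * sqrt 2 * (sqrt 2 - 1) = 17 - 4 * sqrt 2" by (simp add: algebra_simps)
  moreover have "(4 - 2 * sqrt 2) = sqrt 2 * (2 * (sqrt 2 - 1))" by (simp add: algebra_simps)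
  ultimately have R: "(4 - 2 * sqrt 2) / (sqrt 2 * (sqrt (17 - 4 * sqrt 2) + 3))
      = 2 * (sqrt 2 - 1) / (3 + sqrt (9 + 4 * sqrt 2 * (sqrt 2 - 1)))"
    by (simp only: mult_divide_mult_cancel_left_if add.commute[of _ 3]) simp
  show ?thesis unfolding R
  proof (rule is_radius_F2I[OF lemniscate_region M_radius(1,2)[OF \<beta>] _ extremal_in_F2])
    fix f and z :: complex assume "f \<in> F2_class" "norm z < 2 * (sqrt 2 - 1) / (3 + sqrt (9 + 4 * sqrt 2 * (sqrt 2 - 1)))"
    from M_radius(3)[OF \<beta> this] have w: "norm (log_quot f z - 1) < sqrt 2 - 1" .
    define w where "w = log_quot f z"
    have "norm (w + 1) \<le> norm (w - 1) + norm (2::complex)"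
      using norm_triangle_ineq[of "w - 1" 2] by (simp add: add.commute)
    then have "norm (w + 1) < sqrt 2 + 1" using w by (simp add: w_def)
    then have "norm (w - 1) * norm (w + 1) < (sqrt 2 - 1) * (sqrt 2 + 1)"
      using w by (intro mult_strict_mono) (auto simp: w_def)
    also have "\<dots> = 1" by (simp add: algebra_simps)
    also have "norm (w - 1) * norm (w + 1) = norm (w\<^sup>2 - 1)"
      by (simp add: power2_eq_square algebra_simps flip: norm_mult)
    finally have "norm (w\<^sup>2 - 1) < 1" .
    moreover have "Re w > 0"
    proof -
      have "sqrt 2 < 2" by (rule real_less_lsqrt) auto
      moreover have "- Re (w - 1) \<le> norm (w - 1)" using abs_Re_le_cmod[of "w - 1"] by linarith
      ultimately show ?thesis using w by (simp add: w_def)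
    qed
    ultimately show "log_quot f z \<in> {w. norm (w\<^sup>2 - 1) < 1 \<and> Re w > 0}" by (simp add: w_def)
  next
    fix \<rho> assume \<rho>: "2 * (sqrt 2 - 1) / (3 + sqrt (9 + 4 * sqrt 2 * (sqrt 2 - 1))) < \<rho>" "\<rho> < 1"
    have \<rho>0: "\<rho> > 0" using M_radius(1)[OF \<beta>] \<rho> by linarith
    define x where "x = (1 + 3 * \<rho>) / (1 - \<rho>\<^sup>2)"
    have "x > sqrt 2" using M_radius(4)[OF \<beta> \<rho>] by (simp add: x_def)
    then have "x\<^sup>2 > (sqrt 2)\<^sup>2" by (intro power_strict_mono) auto
    moreover have "norm ((of_real x)\<^sup>2 - 1 :: complex) = \<bar>x\<^sup>2 - 1\<bar>"
      by (metis norm_of_real of_real_1 of_real_diff of_real_power)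
    moreover have "log_quot extremal (of_real \<rho>) = of_real x"
      unfolding x_def using \<rho> \<rho>0 by (intro log_quot_extremal_real) auto
    ultimately show "\<exists>\<zeta>. norm \<zeta> = \<rho> \<and> log_quot extremal \<zeta> \<notin> {w. norm (w\<^sup>2 - 1) < 1 \<and> Re w > 0}"
      using \<rho>0 by (intro exI[of _ "of_real \<rho>"]) simp
  qed
qed

text \<open>
  The lower bound for \<open>Re (z f' / f)\<close> may be used because the radius never exceeds \<open>1 / 3\<close>, its value
  for \<open>\<alpha> = 0\<close>.
\<close>

lemma is_radius_starlike:
  assumes \<alpha>: "0 \<le> \<alpha>" "\<alpha> < 1"
  shows "is_radius (starlike_class \<alpha>) F2_class (2 * (1 - \<alpha>) / (3 + sqrt (9 - 4 * \<alpha> + 4 * \<alpha>\<^sup>2)))"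
proof -
  define R where "R = 2 * (1 - \<alpha>) / (3 + sqrt (9 - 4 * \<alpha> + 4 * \<alpha>\<^sup>2))"
  have disc: "9 - 4 * \<alpha> + 4 * \<alpha>\<^sup>2 = 9 + 4 * (- \<alpha>) * (1 - \<alpha>)"
    by (simp add: power2_eq_square algebra_simps)
  have disc0: "9 - 4 * \<alpha> + 4 * \<alpha>\<^sup>2 \<ge> 0" using \<alpha> zero_le_power2[of \<alpha>] by linarith
  have R0: "R > 0" and eq: "- \<alpha> * R\<^sup>2 + 3 * R = 1 - \<alpha>"
    using quadratic_root[of "1 - \<alpha>" "- \<alpha>", folded disc] disc0 \<alpha> by (auto simp: R_def)
  have R1: "R < 1"
  proof -
    define t where "t = 3 + sqrt (9 - 4 * \<alpha> + 4 * \<alpha>\<^sup>2)"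
    have t: "t \<ge> 3" using disc0 by (simp add: t_def)
    then have "R * t = 2 - 2 * \<alpha>" by (simp add: R_def flip: t_def)
    moreover have "R * 3 \<le> R * t" using R0 t by (intro mult_left_mono) auto
    ultimately show ?thesis using \<alpha> by linarith
  qed
  have R3: "R \<le> 1 / 3"
  proof (rule ccontr)
    assume "\<not> R \<le> 1 / 3"
    then have "- \<alpha> * (1 / 3)\<^sup>2 + 3 * (1 / 3) < 1 - \<alpha>"
      using quadratic_strict_mono[of "- \<alpha>" "1 / 3" R] \<alpha> R1 eq by simp
    then show False using \<alpha> by (simp add: power2_eq_square)
  qed
  have "is_radius (starlike_class \<alpha>) F2_class R"
  proof (rule is_radius_F2I[OF starlike_region[OF \<alpha>(1)] R0 R1 _ extremal_in_F2])
    fix f and z :: complex assume f: "f \<in> F2_class" and z: "norm z < R"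
    have d: "1 - (norm z)\<^sup>2 > 0" using z R1 by (simp add: abs_square_less_1)
    have "- \<alpha> * (norm z)\<^sup>2 + 3 * norm z < 1 - \<alpha>"
      using quadratic_strict_mono[of "- \<alpha>" "norm z" R] \<alpha> z R1 eq by simp
    then have "\<alpha> < (1 - 3 * norm z) / (1 - (norm z)\<^sup>2)"
      by (subst pos_less_divide_eq[OF d]) (simp add: algebra_simps)
    also have "\<dots> \<le> Re (log_quot f z)"
      using F2_Re_log_quot[OF f, of z] F2_growth_fractions(2)[of "norm z"] z R3 by simp
    finally show "log_quot f z \<in> {w. Re w > \<alpha>}" by simp
  next
    fix \<rho> assume \<rho>: "R < \<rho>" "\<rho> < 1"
    have d: "1 - \<rho>\<^sup>2 > 0" using \<rho> R0 by (simp add: abs_square_less_1)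
    have "1 - \<alpha> < - \<alpha> * \<rho>\<^sup>2 + 3 * \<rho>"
      using quadratic_strict_mono[of "- \<alpha>" R \<rho>] \<alpha> \<rho> R0 eq by simp
    then have "(1 - 3 * \<rho>) / (1 - \<rho>\<^sup>2) < \<alpha>"
      by (subst pos_divide_less_eq[OF d]) (simp add: algebra_simps)
    moreover have "Re (log_quot extremal (of_real (- \<rho>))) = (1 - 3 * \<rho>) / (1 - \<rho>\<^sup>2)"
      using \<rho> R0 by (subst log_quot_extremal_real) (auto simp del: of_real_divide)
    ultimately show "\<exists>\<zeta>. norm \<zeta> = \<rho> \<and> log_quot extremal \<zeta> \<notin> {w. Re w > \<alpha>}"
      using \<rho> R0 by (intro exI[of _ "of_real (- \<rho>)"]) auto
  qed
  then show ?thesis by (simp only: R_def)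
qed

text \<open>
  The number \<open>sqrt 10 - 3\<close> is the positive root of \<open>r\<^sup>2 + 6 r = 1\<close>, where the difference of the lower
  bound for \<open>Re (z f' / f)\<close> and the upper bound for \<open>|z f' / f - 1|\<close> vanishes.
\<close>

lemma parabolic_admissible: "- 3 + sqrt 10 \<in> admissible_radii parabolic_class F2_class"
  unfolding admissible_radii_F2_iff[OF parabolic_region]
proof (intro conjI ballI)
  define R where "R = - 3 + sqrt 10"
  have "sqrt 10 \<ge> 3" by (rule real_le_rsqrt) simp
  moreover have "sqrt 10 \<le> 10 / 3" by (rule real_le_lsqrt) (auto simp: power2_eq_square)
  ultimately have R: "0 \<le> R" "R \<le> 1 / 3" by (auto simp: R_def)
  then show "0 \<le> - 3 + sqrt 10" "- 3 + sqrt 10 \<le> 1" by (auto simp: R_def)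
  fix f and z :: complex assume f: "f \<in> F2_class" and "z \<in> ball 0 (- 3 + sqrt 10)"
  then have z: "norm z < R" by (simp add: R_def)
  define r where "r = norm z"
  have r: "0 \<le> r" "r < R" "r < 1" using z R by (auto simp: r_def)
  have d: "1 - r\<^sup>2 > 0" using r by (simp add: abs_square_less_1)
  have "(r + 3)\<^sup>2 < (sqrt 10)\<^sup>2"
    using r by (intro power_strict_mono) (auto simp: R_def)
  then have "6 * r < 1 - r\<^sup>2" by (simp add: power2_eq_square algebra_simps)
  then have "0 < (1 - r\<^sup>2 - 6 * r) / (1 - r\<^sup>2)" using d by simp
  also have "\<dots> = (1 - 3 * r) / (1 - r\<^sup>2) - (3 * r + r\<^sup>2) / (1 - r\<^sup>2)"
    unfolding diff_divide_distrib[symmetric] by (simp add: algebra_simps)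
  also have "\<dots> \<le> Re (log_quot f z) - norm (log_quot f z - 1)"
    using F2_Re_log_quot[OF f, of z] F2_norm_log_quot_minus_1[OF f, of z]
      F2_growth_fractions[OF r(1,3)] z R r by (simp add: r_def)
  finally show "log_quot f z \<in> {w. Re w > norm (w - 1)}" by simp
qed

theorem theorem2p2:
  shows "is_radius lemniscate_class F2_class
           ((4 - 2 * sqrt 2) / (sqrt 2 * (sqrt (17 - 4 * sqrt 2) + 3))) \<and>
         (\<forall>\<beta>::real. \<beta> > 1 \<longrightarrow>
           is_radius (M_class \<beta>) F2_class
             (2 * (\<beta> - 1) / (3 + sqrt (9 + 4 * \<beta> * (\<beta> - 1))))) \<and>
         (\<forall>\<alpha>::real. 0 \<le> \<alpha> \<and> \<alpha> < 1 \<longrightarrow>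
           is_radius (starlike_class \<alpha>) F2_class
             (2 * (1 - \<alpha>) / (3 + sqrt (9 - 4 * \<alpha> + 4 * \<alpha>\<^sup>2)))) \<and>
         (\<exists>R. is_radius parabolic_class F2_class R \<and> R \<ge> - 3 + sqrt 10)"
proof -
  have "is_radius parabolic_class F2_class (Sup (admissible_radii parabolic_class F2_class))"
    by (rule is_radius_F2_Sup[OF parabolic_region])
  then have "\<exists>R. is_radius parabolic_class F2_class R \<and> R \<ge> - 3 + sqrt 10"
    using parabolic_admissible unfolding is_radius_def by blast
  then show ?thesis
    using is_radius_lemniscate is_radius_M is_radius_starlike by blast
qed

end
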